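(* Let $\mathbb{K}$ be a field and let $P$ be a finite poset such that for every $x,y\in P$ the set of minimal elements of $\{z\in P: x\le z,\ y\le z\}$ has at most one element, such that $P$ has a minimum element $\hat 0$, $P$ is ranked with rank function $\rho$, and $\rho(x\vee y)\le\rho(x)+\rho(y)$ whenever $x\vee y$ exists. Let $\tilde P$ be the small category defined below and $\ell\colon\operatorname{Mor}(\tilde P)\to P$, $\ell(f^d_{x,y})=d$. Then the schemoid algebra $\mathbb{K}(\tilde P,P,\ell)$ is isomorphic to the ring $R_P=\mathbb{K}[X_x : x\in P]/I$, where $I$ is the ideal generated by $X_{\hat 0}-1$; all $X_xX_y$ with $x\vee y$ existing and $\rho(x\vee y)<\rho(x)+\rho(y)$; all $X_xX_y$ such that $x$ and $y$ have no common upper bound; and all $X_xX_y-X_{x\vee y}$ with $\rho(x\vee y)=\rho(x)+\rho(y)$.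
   Context: For $x,y\in P$ with a common upper bound, $x\vee y$ is the minimum of $\{z: x\le z,\ y\le z\}$. The category $\tilde P$ has object set $P$ and $\operatorname{Hom}_{\tilde P}(x,y)=\{f^d_{x,y}: d\in P,\ y=x\vee d,\ \rho(y)=\rho(x)+\rho(d)\}$ (distinct triples $(x,y,d)$ giving distinct morphisms), with composition $f^d_{y,z}\circ f^c_{x,y}=f^{d\vee c}_{x,z}$. For a small category $\mathcal{C}$ with finitely many objects, the category algebra $\mathbb{K}[\mathcal{C}]$ is the $\mathbb{K}$-vector space with basis $\operatorname{Mor}(\mathcal{C})$ and product extended bilinearly from $g\cdot f=g\circ f$ if the source of $g$ equals the target of $f$ and $g\cdot f=0$ otherwise. For a map $\ell\colon\operatorname{Mor}(\mathcal{C})\to I$ with finite fibers and $i\in I$, set $\overline{i}=\sum_{f:\ell(f)=i}f$; the schemoid algebra $\mathbb{K}(\mathcal{C},I,\ell)$ is the subspace of $\mathbb{K}[\mathcal{C}]$ spanned by $\{\overline{i}: i\in I\}$, which is a subalgebra when $(\mathcal{C},I,\ell)$ is a schemoid (i.e. when, writing $N^{i,j}_h=\{(f,g):\ell(f)=i,\ \ell(g)=j,\ f\circ g=h\}$, $\ell(h)=\ell(k)$ implies $|N^{i,j}_h|=|N^{i,j}_k|$). *)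

theory Defs
  imports
    "HOL-Library.Poly_Mapping"
    "HOL-Algebra.QuotRing"
    "HOL-Algebra.Module"
    "HOL-Algebra.Algebraic_Closure_Type"
begin

section \<open>Small categories, category algebras and schemoid algebras\<close>

record ('o, 'm) category =
  Obj :: "'o set"
  Mor :: "'m set"
  src :: "'m \<Rightarrow> 'o"
  tgt :: "'m \<Rightarrow> 'o"
  ident :: "'o \<Rightarrow> 'm"
  Comp :: "'m \<Rightarrow> 'm \<Rightarrow> 'm"

text \<open>\<^term>\<open>Comp C g f\<close> is the composite of \<open>g\<close> after \<open>f\<close>; it is only meaningful if the source of
  \<open>g\<close> is the target of \<open>f\<close>.\<close>

locale small_category =
  fixes C :: "('o, 'm) category"
  assumes src_in: "f \<in> Mor C \<Longrightarrow> src C f \<in> Obj C"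
    and tgt_in: "f \<in> Mor C \<Longrightarrow> tgt C f \<in> Obj C"
    and ident_in: "x \<in> Obj C \<Longrightarrow> ident C x \<in> Mor C"
    and src_ident: "x \<in> Obj C \<Longrightarrow> src C (ident C x) = x"
    and tgt_ident: "x \<in> Obj C \<Longrightarrow> tgt C (ident C x) = x"
    and comp_in: "\<lbrakk>f \<in> Mor C; g \<in> Mor C; src C g = tgt C f\<rbrakk> \<Longrightarrow> Comp C g f \<in> Mor C"
    and src_comp: "\<lbrakk>f \<in> Mor C; g \<in> Mor C; src C g = tgt C f\<rbrakk> \<Longrightarrow> src C (Comp C g f) = src C f"
    and tgt_comp: "\<lbrakk>f \<in> Mor C; g \<in> Mor C; src C g = tgt C f\<rbrakk> \<Longrightarrow> tgt C (Comp C g f) = tgt C g"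
    and comp_ident_right: "f \<in> Mor C \<Longrightarrow> Comp C f (ident C (src C f)) = f"
    and comp_ident_left: "f \<in> Mor C \<Longrightarrow> Comp C (ident C (tgt C f)) f = f"
    and comp_assoc: "\<lbrakk>f \<in> Mor C; g \<in> Mor C; h \<in> Mor C; src C g = tgt C f; src C h = tgt C g\<rbrakk>
        \<Longrightarrow> Comp C h (Comp C g f) = Comp C (Comp C h g) f"

definition scale :: "'k \<Rightarrow> ('b \<Rightarrow>\<^sub>0 'k) \<Rightarrow> ('b \<Rightarrow>\<^sub>0 'k::field)"
  where "scale c a = Poly_Mapping.map ((*) c) a"

lemma lookup_scale [simp]: "Poly_Mapping.lookup (scale c a) b = c * Poly_Mapping.lookup a b"
  by (simp add: scale_def Poly_Mapping.map.rep_eq when_def)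

lemma vector_space_scale: "vector_space (scale :: 'k::field \<Rightarrow> ('b \<Rightarrow>\<^sub>0 'k) \<Rightarrow> _)"
  by unfold_locales (auto intro!: poly_mapping_eqI simp: lookup_add algebra_simps)

text \<open>The finitely supported functions on the morphisms form the vector space with basis
  \<^term>\<open>Mor C\<close>, the basis vector of \<open>f\<close> being \<open>Poly_Mapping.single f 1\<close>. The unit below presupposes
  finitely many objects.\<close>

definition category_algebra :: "('o, 'm) category \<Rightarrow> ('k::field, 'm \<Rightarrow>\<^sub>0 'k) module"
  where "category_algebra C =
    \<lparr> carrier = {a. Poly_Mapping.keys a \<subseteq> Mor C},
      monoid.mult = (\<lambda>a b. \<Sum>g\<in>Poly_Mapping.keys a. \<Sum>f\<in>Poly_Mapping.keys b.
         if src C g = tgt C f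
         then Poly_Mapping.single (Comp C g f) (Poly_Mapping.lookup a g * Poly_Mapping.lookup b f)
         else 0),
      one = (\<Sum>x\<in>Obj C. Poly_Mapping.single (ident C x) 1),
      ring.zero = 0,
      add = (+),
      module.smult = scale \<rparr>"

definition factorizations ::
    "('o, 'm) category \<Rightarrow> ('m \<Rightarrow> 'i) \<Rightarrow> 'i \<Rightarrow> 'i \<Rightarrow> 'm \<Rightarrow> ('m \<times> 'm) set"
  where "factorizations C lbl i j h =
    {(f, g). f \<in> Mor C \<and> g \<in> Mor C \<and> src C f = tgt C g \<and> lbl f = i \<and> lbl g = j \<and> Comp C f g = h}"

text \<open>Finiteness of the fibers makes all the cardinalities below genuine.\<close>

locale schemoid = small_category C
  for C :: "('o, 'm) category" and I :: "'i set" and lbl :: "'m \<Rightarrow> 'i" +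
  assumes label_in: "f \<in> Mor C \<Longrightarrow> lbl f \<in> I"
    and finite_fibers: "i \<in> I \<Longrightarrow> finite {f \<in> Mor C. lbl f = i}"
    and card_factorizations: "\<lbrakk>i \<in> I; j \<in> I; h \<in> Mor C; k \<in> Mor C; lbl h = lbl k\<rbrakk>
        \<Longrightarrow> card (factorizations C lbl i j h) = card (factorizations C lbl i j k)"

definition fiber_sum :: "('o, 'm) category \<Rightarrow> ('m \<Rightarrow> 'i) \<Rightarrow> 'i \<Rightarrow> ('m \<Rightarrow>\<^sub>0 'k::field)"
  where "fiber_sum C lbl i = (\<Sum>f\<in>{f \<in> Mor C. lbl f = i}. Poly_Mapping.single f 1)"

definition schemoid_algebra ::
    "('o, 'm) category \<Rightarrow> 'i set \<Rightarrow> ('m \<Rightarrow> 'i) \<Rightarrow> ('k::field, 'm \<Rightarrow>\<^sub>0 'k) module"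
  where "schemoid_algebra C I lbl =
    (category_algebra C)\<lparr>carrier := module.span scale (fiber_sum C lbl ` I)\<rparr>"

definition algebra_iso :: "('k, 'a) module \<Rightarrow> ('k, 'b) module \<Rightarrow> ('a \<Rightarrow> 'b) set"
  where "algebra_iso A B =
    {h \<in> ring_iso A B. \<forall>c. \<forall>a\<in>carrier A. h (c \<odot>\<^bsub>A\<^esub> a) = c \<odot>\<^bsub>B\<^esub> h a}"


section \<open>Ranked posets with joins\<close>

definition upper_bounds :: "'p::order \<Rightarrow> 'p \<Rightarrow> 'p set"
  where "upper_bounds x y = {z. x \<le> z \<and> y \<le> z}"

definition minimal_elements :: "'p::order set \<Rightarrow> 'p set"
  where "minimal_elements A = {z \<in> A. \<forall>w\<in>A. w \<le> z \<longrightarrow> w = z}"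

text \<open>An arbitrary value unless the set of upper bounds has a minimum.\<close>

definition poset_join :: "'p::order \<Rightarrow> 'p \<Rightarrow> 'p"
  where "poset_join x y = (LEAST z. z \<in> upper_bounds x y)"

definition covers :: "'p::order \<Rightarrow> 'p \<Rightarrow> bool"
  where "covers y x \<longleftrightarrow> x < y \<and> (\<nexists>z. x < z \<and> z < y)"

definition rank_function :: "('p::order \<Rightarrow> nat) \<Rightarrow> bool"
  where "rank_function \<rho> \<longleftrightarrow>
    (\<forall>x \<in> minimal_elements UNIV. \<rho> x = 0) \<and> (\<forall>x y. covers y x \<longrightarrow> \<rho> y = \<rho> x + 1)"

text \<open>The triple \<open>(x, y, d)\<close> encodes the morphism from \<open>x\<close> to \<open>y\<close> with label \<open>d\<close>.\<close>

definition poset_category ::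
    "('p::order_bot \<Rightarrow> nat) \<Rightarrow> ('p, 'p \<times> 'p \<times> 'p) category"
  where "poset_category \<rho> =
    \<lparr> Obj = UNIV,
      Mor = {(x, y, d). upper_bounds x d \<noteq> {} \<and> y = poset_join x d \<and> \<rho> y = \<rho> x + \<rho> d},
      src = (\<lambda>(x, y, d). x),
      tgt = (\<lambda>(x, y, d). y),
      ident = (\<lambda>x. (x, x, bot)),
      Comp = (\<lambda>(y, z, d) (x, y', c). (x, z, poset_join d c)) \<rparr>"

definition label :: "'p \<times> 'p \<times> 'p \<Rightarrow> 'p"
  where "label = (\<lambda>(x, y, d). d)"


section \<open>The ring of a ranked poset\<close>

text \<open>Monomials in the variables \<open>Var x\<close> are the finitely supported exponent vectors
  \<open>'p \<Rightarrow>\<^sub>0 nat\<close>; the ring structure on \<open>('p \<Rightarrow>\<^sub>0 nat) \<Rightarrow>\<^sub>0 'k\<close> is the convolution product, so this is the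
  polynomial ring over \<open>'k\<close> in variables indexed by \<open>'p\<close>.\<close>

type_synonym ('p, 'k) mpolynomial = "('p \<Rightarrow>\<^sub>0 nat) \<Rightarrow>\<^sub>0 'k"

definition Var :: "'p \<Rightarrow> ('p, 'k::field) mpolynomial"
  where "Var x = Poly_Mapping.single (Poly_Mapping.single x 1) 1"

definition Const :: "'k \<Rightarrow> ('p, 'k::field) mpolynomial"
  where "Const c = Poly_Mapping.single 0 c"

definition poset_relations :: "('p::order_bot \<Rightarrow> nat) \<Rightarrow> ('p, 'k::field) mpolynomial set"
  where "poset_relations \<rho> =
      {Var bot - 1}
    \<union> {Var x * Var y | x y. upper_bounds x y \<noteq> {} \<and> \<rho> (poset_join x y) < \<rho> x + \<rho> y}
    \<union> {Var x * Var y | x y. upper_bounds x y = {}}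
    \<union> {Var x * Var y - Var (poset_join x y) | x y. upper_bounds x y \<noteq> {} \<and> \<rho> (poset_join x y) = \<rho> x + \<rho> y}"

definition poset_ideal :: "('p::order_bot \<Rightarrow> nat) \<Rightarrow> ('p, 'k::field) mpolynomial set"
  where "poset_ideal \<rho> = genideal ring_of_type_algebra (poset_relations \<rho>)"

definition poset_ring ::
    "('p::order_bot \<Rightarrow> nat) \<Rightarrow> ('k::field, ('p, 'k) mpolynomial set) module"
  where "poset_ring \<rho> =
    ring.extend (ring_of_type_algebra Quot poset_ideal \<rho>)
      (module.fields (\<lambda>c A. (poset_ideal \<rho> +>\<^bsub>ring_of_type_algebra\<^esub> Const c)
         \<otimes>\<^bsub>ring_of_type_algebra Quot poset_ideal \<rho>\<^esub> A))"


section \<open>Well-formedness of the constructions\<close>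

lemma poset_join_least:
  fixes x y :: "'p::{finite, order}"
  assumes min: "\<And>x y :: 'p. card (minimal_elements (upper_bounds x y)) \<le> 1"
    and ub: "upper_bounds x y \<noteq> {}"
  shows "poset_join x y \<in> upper_bounds x y" and "z \<in> upper_bounds x y \<Longrightarrow> poset_join x y \<le> z"
proof -
  let ?U = "upper_bounds x y"
  have below: "\<exists>m \<in> minimal_elements ?U. m \<le> z" if z: "z \<in> ?U" for z
  proof -
    obtain m where m: "m \<in> ?U" "m \<le> z" "\<forall>b\<in>?U. b \<le> m \<longrightarrow> m = b"
      using finite_has_minimal2[of ?U z] z by auto
    then show ?thesis unfolding minimal_elements_def by auto
  qed
  obtain m where m: "m \<in> minimal_elements ?U" using ub below by blast
  have uniq: "w = m" if "w \<in> minimal_elements ?U" for w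
    using min[of x y] m that card_le_Suc0_iff_eq[of "minimal_elements ?U"] by auto
  have mU: "m \<in> ?U" using m by (simp add: minimal_elements_def)
  have least: "m \<le> z" if "z \<in> ?U" for z using below[OF that] uniq by blast
  have j: "poset_join x y = m" unfolding poset_join_def by (rule Least_equality) (use mU least in auto)
  show "poset_join x y \<in> ?U" using j mU by simp
  show "z \<in> ?U \<Longrightarrow> poset_join x y \<le> z" using j least by simp
qed

lemma schemoid_poset_category:
  fixes \<rho> :: "'p::{finite, order_bot} \<Rightarrow> nat"
  assumes min: "\<And>x y :: 'p. card (minimal_elements (upper_bounds x y)) \<le> 1"
    and rank: "rank_function \<rho>"
    and sub: "\<And>x y. upper_bounds x y \<noteq> {} \<Longrightarrow> \<rho> (poset_join x y) \<le> \<rho> x + \<rho> y"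
  shows "schemoid (poset_category \<rho>) UNIV label"
proof -
  define M where "M x y d \<longleftrightarrow> upper_bounds x d \<noteq> {} \<and> y = poset_join x d \<and> \<rho> y = \<rho> x + \<rho> d" for x y d
  have Mor: "Mor (poset_category \<rho>) = {(x, y, d). M x y d}"
    by (simp add: poset_category_def M_def)
  have joinI: "upper_bounds x y \<noteq> {} \<and> poset_join x y = u"
    if "x \<le> u" "y \<le> u" "\<And>z. x \<le> z \<Longrightarrow> y \<le> z \<Longrightarrow> u \<le> z" for x y u :: 'p
    using that unfolding poset_join_def upper_bounds_def by (auto intro!: Least_equality)
  have joinD: "x \<le> poset_join x y" "y \<le> poset_join x y" "x \<le> z \<Longrightarrow> y \<le> z \<Longrightarrow> poset_join x y \<le> z"
    if "upper_bounds x y \<noteq> {}" for x y z :: 'p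
    using poset_join_least[OF min that] by (auto simp: upper_bounds_def)
  have ubI: "upper_bounds x y \<noteq> {}" if "x \<le> z" "y \<le> z" for x y z :: 'p
    using that by (auto simp: upper_bounds_def)
  have Mub: "x \<le> y" "d \<le> y" "x \<le> z \<Longrightarrow> d \<le> z \<Longrightarrow> y \<le> z" if "M x y d" for x y z d
    using that joinD unfolding M_def by blast+
  have bot0: "\<rho> bot = 0"
    using rank unfolding rank_function_def minimal_elements_def by (auto simp: bot_unique)
  have jb: "poset_join d bot = d" "poset_join bot d = d" for d :: 'p
    using joinI[of d d bot] joinI[of bot d d] by auto
  have Mid: "M x x bot" for x using joinI[of x x bot] bot0 unfolding M_def by simp
  have Mcomp: "M x z (poset_join d c) \<and> \<rho> (poset_join d c) = \<rho> d + \<rho> c \<and> upper_bounds d c \<noteq> {}"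
    if 1: "M x y c" and 2: "M y z d" for x y z c d
  proof -
    have le: "x \<le> z" "c \<le> z" "d \<le> z" using Mub[OF 1] Mub[OF 2] by auto
    have ub: "upper_bounds d c \<noteq> {}" using ubI le by blast
    have z: "upper_bounds x (poset_join d c) \<noteq> {} \<and> poset_join x (poset_join d c) = z"
    proof (rule joinI)
      show "x \<le> z" by fact
      show "poset_join d c \<le> z" using joinD[OF ub] le by blast
      fix w assume w: "x \<le> w" "poset_join d c \<le> w"
      then have "c \<le> w" "d \<le> w" using joinD(1,2)[OF ub] by order+
      then show "z \<le> w" using Mub[OF 1] Mub[OF 2] w by blast
    qed
    have "\<rho> y = \<rho> x + \<rho> c" "\<rho> z = \<rho> y + \<rho> d" using 1 2 unfolding M_def by blast+
    moreover have "\<rho> z \<le> \<rho> x + \<rho> (poset_join d c)" using sub z by metis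
    moreover have "\<rho> (poset_join d c) \<le> \<rho> d + \<rho> c" using sub ub by blast
    ultimately show ?thesis using z ub unfolding M_def by auto
  qed
  have assoc: "poset_join e (poset_join d c) = poset_join (poset_join e d) c"
    if le: "c \<le> z" "d \<le> z" "e \<le> z" for c d e z :: 'p
  proof -
    have u: "upper_bounds d c \<noteq> {}" "upper_bounds e d \<noteq> {}" using ubI le by blast+
    have v: "upper_bounds (poset_join e d) c \<noteq> {}"
      by (rule ubI[of _ z]) (use joinD(3)[OF u(2)] le in auto)
    show ?thesis
    proof (rule joinI[THEN conjunct2])
      show "e \<le> poset_join (poset_join e d) c"
        using joinD(1)[OF u(2)] joinD(1)[OF v] by (rule order_trans)
      have "d \<le> poset_join (poset_join e d) c"
        using joinD(2)[OF u(2)] joinD(1)[OF v] by (rule order_trans)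
      then show "poset_join d c \<le> poset_join (poset_join e d) c"
        using joinD(3)[OF u(1)] joinD(2)[OF v] by simp
      fix w assume w: "e \<le> w" "poset_join d c \<le> w"
      have "d \<le> w" "c \<le> w"
        using joinD(1,2)[OF u(1)] w(2) by order+
      then show "poset_join (poset_join e d) c \<le> w"
        using joinD(3)[OF u(2)] joinD(3)[OF v] w(1) by simp
    qed
  qed
  have fac: "card (factorizations (poset_category \<rho>) label i j (x, y, d)) =
      (if upper_bounds i j \<noteq> {} \<and> poset_join i j = d \<and> \<rho> d = \<rho> i + \<rho> j then 1 else 0)"
    if m: "M x y d" for i j x y d
  proof -
    let ?F = "factorizations (poset_category \<rho>) label i j (x, y, d)"
    have F: "?F = {((u, y, i), (x, u, j)) | u. M x u j \<and> M u y i \<and> poset_join i j = d}"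
      unfolding factorizations_def Mor by (auto simp: poset_category_def label_def)
    show ?thesis
    proof (cases "upper_bounds i j \<noteq> {} \<and> poset_join i j = d \<and> \<rho> d = \<rho> i + \<rho> j")
      case True
      have "i \<le> d" "j \<le> d" using True joinD(1,2)[of i j] by auto
      then have dy: "i \<le> y" "j \<le> y" "x \<le> y"
        using Mub(1,2)[OF m] by simp_all
      define u where "u = poset_join x j"
      have ux: "upper_bounds x j \<noteq> {}" using ubI dy by blast
      have uy: "u \<le> y" using joinD[OF ux] dy u_def by blast
      have ui: "upper_bounds u i \<noteq> {} \<and> poset_join u i = y"
      proof (rule joinI)
        fix z assume z: "u \<le> z" "i \<le> z"
        then have "x \<le> z" "j \<le> z" using joinD(1,2)[OF ux, folded u_def] by order+
        then show "y \<le> z" using Mub[OF m] joinD[of i j] True z by blast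
      qed (use uy dy in auto)
      have "\<rho> y = \<rho> x + \<rho> d" "\<rho> d = \<rho> i + \<rho> j" using m True unfolding M_def by blast+
      moreover have "\<rho> y \<le> \<rho> u + \<rho> i" using sub ui by metis
      moreover have "\<rho> u \<le> \<rho> x + \<rho> j" using sub ux u_def by metis
      ultimately have "M x u j" "M u y i" using ux ui u_def unfolding M_def by auto
      then have "?F = {((u, y, i), (x, u, j))}"
        using True unfolding F by (auto simp: M_def)
      then show ?thesis using True by simp
    next
      case False
      have "?F = {}" using False Mcomp unfolding F by blast
      then show ?thesis using False by (metis card.empty)
    qed
  qed
  show ?thesis
  proof
    fix f g h
    let ?C = "poset_category \<rho>"
    show "f \<in> Mor ?C \<Longrightarrow> src ?C f \<in> Obj ?C" "f \<in> Mor ?C \<Longrightarrow> tgt ?C f \<in> Obj ?C"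
      by (auto simp: poset_category_def)
    show "f \<in> Mor ?C \<Longrightarrow> Comp ?C f (ident ?C (src ?C f)) = f"
      "f \<in> Mor ?C \<Longrightarrow> Comp ?C (ident ?C (tgt ?C f)) f = f"
      by (auto simp: poset_category_def jb)
    assume fg: "f \<in> Mor ?C" "g \<in> Mor ?C" "src ?C g = tgt ?C f"
    then obtain x y z c d where e: "f = (x, y, c)" "g = (y, z, d)" "M x y c" "M y z d"
      unfolding Mor by (auto simp: poset_category_def)
    show "Comp ?C g f \<in> Mor ?C" using e Mcomp unfolding Mor by (auto simp: poset_category_def)
    show "src ?C (Comp ?C g f) = src ?C f" "tgt ?C (Comp ?C g f) = tgt ?C g"
      using e by (auto simp: poset_category_def)
    assume h: "h \<in> Mor ?C" "src ?C h = tgt ?C g"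
    then obtain w b where h': "h = (z, w, b)" "M z w b"
      using e unfolding Mor by (auto simp: poset_category_def)
    have "c \<le> w" "d \<le> w" "b \<le> w"
      using Mub(1,2)[OF e(3)] Mub(1,2)[OF e(4)] Mub(1,2)[OF h'(2)] by order+
    then show "Comp ?C h (Comp ?C g f) = Comp ?C (Comp ?C h g) f"
      using assoc e h' by (simp add: poset_category_def)
  next
    fix x
    let ?C = "poset_category \<rho>"
    show "ident ?C x \<in> Mor ?C" "src ?C (ident ?C x) = x" "tgt ?C (ident ?C x) = x"
      using Mid unfolding Mor by (auto simp: poset_category_def)
  next
    fix i j h k
    assume "h \<in> Mor (poset_category \<rho>)" "k \<in> Mor (poset_category \<rho>)" "label h = label k"
    then show "card (factorizations (poset_category \<rho>) label i j h) =
        card (factorizations (poset_category \<rho>) label i j k)"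
      using fac unfolding Mor by (auto simp: label_def)
  qed auto
qed

end

theory Submission
  imports Defs
begin

text \<open>An element of the schemoid algebra is determined by its coefficients \<open>a\<^sub>d\<close> at the morphisms
  \<open>(bot, d, d)\<close>, and the isomorphism sends it to the class of \<open>\<Sum>a\<^sub>d X\<^sub>d\<close>. Multiplicativity holds because
  the only factorizations of \<open>(bot, p, p)\<close> are \<open>(c, p, d) \<circ> (bot, c, c)\<close> with \<open>p = d \<or> c\<close> of rank
  \<open>\<rho> d + \<rho> c\<close>. The relations reduce every monomial to a variable or to zero, so the map is onto. For
  injectivity, a monomial \<open>m\<close> has normal form \<open>p\<close> if \<open>p\<close> is the least upper bound of its support and
  \<open>\<rho> p\<close> is the weighted degree of \<open>m\<close>; summing the coefficients of all monomials with normal form \<open>p\<close>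
  gives a functional that vanishes on the ideal and reads off the coefficient of \<open>X\<^sub>p\<close> in a linear form.\<close>

section \<open>Polynomial rings as HOL-Algebra structures\<close>

abbreviation poly_ring :: "('p, 'k::field) mpolynomial ring"
  where "poly_ring \<equiv> ring_of_type_algebra"

lemma ring_of_type_algebra_simps [simp]:
  fixes x y :: "'a::comm_ring_1"
  shows "carrier (ring_of_type_algebra :: 'a ring) = UNIV"
    and "x \<otimes>\<^bsub>ring_of_type_algebra\<^esub> y = x * y"
    and "x \<oplus>\<^bsub>ring_of_type_algebra\<^esub> y = x + y"
    and "\<one>\<^bsub>ring_of_type_algebra\<^esub> = (1 :: 'a)"
    and "\<zero>\<^bsub>ring_of_type_algebra\<^esub> = (0 :: 'a)"
  by (simp_all add: ring_of_type_algebra_def)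

lemma a_inv_ring_of_type_algebra [simp]: "\<ominus>\<^bsub>ring_of_type_algebra\<^esub> x = - x"
  for x :: "'a::comm_ring_1"
proof -
  interpret ring "ring_of_type_algebra :: 'a ring" by (rule ring_from_type_algebra)
  show ?thesis by (rule minus_equality) auto
qed

lemma a_minus_ring_of_type_algebra [simp]: "x \<ominus>\<^bsub>ring_of_type_algebra\<^esub> y = x - y"
  for x y :: "'a::comm_ring_1"
  by (simp add: a_minus_def)

lemma poly_mapping_single_induct [case_names zero add]:
  fixes f :: "'a \<Rightarrow>\<^sub>0 'b::monoid_add"
  assumes "P 0" and "\<And>f a b. P f \<Longrightarrow> P (f + Poly_Mapping.single a b)"
  shows "P f"
proof (induction f rule: update_induct)
  case const
  show ?case by fact
next
  case (update f a b)
  have "Poly_Mapping.update a b f = f + Poly_Mapping.single a b"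
    using update(1)
    by (intro poly_mapping_eqI) (auto simp: lookup_update lookup_add lookup_single in_keys_iff when_def)
  then show ?case using update assms(2) by simp
qed

text \<open>Exponents grow by one, so each step is multiplication by a single variable; it
  corresponds to one binary join or one use of a quadratic relation.\<close>

lemma monomial_induct [case_names zero add]:
  fixes m :: "'a \<Rightarrow>\<^sub>0 nat"
  assumes "P 0" and "\<And>m a. P m \<Longrightarrow> P (m + Poly_Mapping.single a 1)"
  shows "P m"
proof (induction m rule: poly_mapping_single_induct)
  case zero
  show ?case by fact
next
  case (add m a b)
  then show ?case
  proof (induction b)
    case (Suc b)
    have "m + Poly_Mapping.single a (Suc b) = m + Poly_Mapping.single a b + Poly_Mapping.single a 1"
      by (simp add: add.assoc flip: single_add)
    then show ?case using Suc assms(2) by simp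
  qed simp
qed

section \<open>Joins in a ranked poset with subadditive rank\<close>

locale ranked_join_poset =
  fixes \<rho> :: "'p::{finite, order_bot} \<Rightarrow> nat"
  assumes unique_minimal: "\<And>x y :: 'p. card (minimal_elements (upper_bounds x y)) \<le> 1"
    and rank: "rank_function \<rho>"
    and rank_join_le: "\<And>x y. upper_bounds x y \<noteq> {} \<Longrightarrow> \<rho> (poset_join x y) \<le> \<rho> x + \<rho> y"
begin

lemma join_le_iff: "upper_bounds x y \<noteq> {} \<Longrightarrow> poset_join x y \<le> z \<longleftrightarrow> x \<le> z \<and> y \<le> z" for x y z :: 'p
  using poset_join_least[OF unique_minimal, of x y] unfolding upper_bounds_def
  by (metis (no_types, lifting) mem_Collect_eq order_trans)

lemma rank_bot [simp]: "\<rho> bot = 0"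
  using rank unfolding rank_function_def minimal_elements_def by (auto simp: bot_unique)

text \<open>One relation serves both algebras: it is the condition for a morphism from
  \<open>x\<close> to \<open>z\<close> with label \<open>y\<close>, and for the product of the
  variables of \<open>x\<close> and \<open>y\<close> to be congruent to the variable of
  \<open>z\<close>.\<close>

definition additive_join :: "'p \<Rightarrow> 'p \<Rightarrow> 'p \<Rightarrow> bool"
  where "additive_join x y z \<longleftrightarrow> upper_bounds x y \<noteq> {} \<and> poset_join x y = z \<and> \<rho> z = \<rho> x + \<rho> y"

lemma join_eqI:
  fixes x y :: 'p
  assumes "\<And>w. z \<le> w \<longleftrightarrow> x \<le> w \<and> y \<le> w"
  shows "upper_bounds x y \<noteq> {}" "poset_join x y = z"
proof -
  show u: "upper_bounds x y \<noteq> {}" using assms[of z] by (auto simp: upper_bounds_def)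
  show "poset_join x y = z" using join_le_iff[OF u] assms by (meson order.antisym order.refl)
qed

text \<open>The elements above \<open>z\<close> determine the join, and \<open>w = z\<close>
  supplies the common upper bound. In this form symmetry in \<open>x\<close> and \<open>y\<close> is
  evident.\<close>

lemma additive_join_iff:
  "additive_join x y z \<longleftrightarrow> (\<forall>w. z \<le> w \<longleftrightarrow> x \<le> w \<and> y \<le> w) \<and> \<rho> z = \<rho> x + \<rho> y"
  unfolding additive_join_def using join_eqI[of z x y] join_le_iff[of x y] by metis

lemma additive_join_bot_left [simp]: "additive_join bot x y \<longleftrightarrow> x = y"
  unfolding additive_join_iff by (auto intro: order.antisym)

subsection \<open>Normal forms of monomials\<close>

definition monomial_rank :: "('p \<Rightarrow>\<^sub>0 nat) \<Rightarrow> nat"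
  where "monomial_rank m = (\<Sum>x\<in>UNIV. Poly_Mapping.lookup m x * \<rho> x)"

lemma monomial_rank_simps [simp]:
  "monomial_rank 0 = 0" "monomial_rank (m + n) = monomial_rank m + monomial_rank n"
  "monomial_rank (Poly_Mapping.single x (Suc 0)) = \<rho> x"
  by (simp_all add: monomial_rank_def lookup_add algebra_simps sum.distrib lookup_single when_def
      if_distrib[of "\<lambda>c. _ * c"] cong: if_cong)

definition monomial_bound :: "('p \<Rightarrow>\<^sub>0 nat) \<Rightarrow> 'p \<Rightarrow> bool"
  where "monomial_bound m z \<longleftrightarrow> (\<forall>x\<in>Poly_Mapping.keys m. x \<le> z)"

lemma monomial_bound_simps [simp]:
  "monomial_bound 0 z" "monomial_bound (m + n) z \<longleftrightarrow> monomial_bound m z \<and> monomial_bound n z"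
  "monomial_bound (Poly_Mapping.single x (Suc 0)) z \<longleftrightarrow> x \<le> z"
  by (auto simp: monomial_bound_def in_keys_iff lookup_add lookup_single when_def)

text \<open>The monomials \<open>m\<close> with \<open>normal_form m p\<close> are those congruent to the variable of \<open>p\<close>; a monomial
  without normal form lies in the ideal.\<close>

definition normal_form :: "('p \<Rightarrow>\<^sub>0 nat) \<Rightarrow> 'p \<Rightarrow> bool"
  where "normal_form m p \<longleftrightarrow> (\<forall>z. p \<le> z \<longleftrightarrow> monomial_bound m z) \<and> \<rho> p = monomial_rank m"

lemma normal_form_zero [simp]: "normal_form 0 p \<longleftrightarrow> p = bot"
  by (auto simp: normal_form_def intro: order.antisym)

lemma normal_form_single [simp]: "normal_form (Poly_Mapping.single x (Suc 0)) p \<longleftrightarrow> p = x"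
  by (auto simp: normal_form_def intro: order.antisym)

lemma normal_form_unique: "normal_form m p \<Longrightarrow> normal_form m q \<Longrightarrow> p = q"
  unfolding normal_form_def by (meson order.antisym order.refl)

text \<open>Join the variables one at a time: the bound \<open>z\<close> makes each partial join
  exist, and subadditivity controls its rank.\<close>

lemma bounded_monomial_lub:
  assumes "monomial_bound m z"
  shows "\<exists>q. (\<forall>w. q \<le> w \<longleftrightarrow> monomial_bound m w) \<and> \<rho> q \<le> monomial_rank m"
  using assms
proof (induction m rule: monomial_induct)
  case zero
  show ?case by (rule exI[of _ bot]) simp
next
  case (add m a)
  then obtain q where q: "\<And>w. q \<le> w \<longleftrightarrow> monomial_bound m w" "\<rho> q \<le> monomial_rank m" by auto
  have u: "upper_bounds q a \<noteq> {}" using add.prems q(1) by (auto simp: upper_bounds_def)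
  show ?case
    by (rule exI[of _ "poset_join q a"]) (use rank_join_le[OF u] join_le_iff[OF u] q in simp)
qed

lemma normal_form_add:
  "normal_form (m + n) p \<longleftrightarrow> (\<exists>q r. normal_form m q \<and> normal_form n r \<and> additive_join q r p)"
proof
  assume p: "normal_form (m + n) p"
  then have "monomial_bound m p" "monomial_bound n p" unfolding normal_form_def by auto
  then obtain q r where q: "\<And>w. q \<le> w \<longleftrightarrow> monomial_bound m w" "\<rho> q \<le> monomial_rank m"
    and r: "\<And>w. r \<le> w \<longleftrightarrow> monomial_bound n w" "\<rho> r \<le> monomial_rank n"
    using bounded_monomial_lub by meson
  have j: "upper_bounds q r \<noteq> {}" "poset_join q r = p"
    using join_eqI[of p q r] p q(1) r(1) unfolding normal_form_def by auto
  \<comment> \<open>The chain \<open>\<rho> p \<le> \<rho> q + \<rho> r \<le> monomial_rank m +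
    monomial_rank n = \<rho> p\<close> forces equality throughout.\<close>
  have "\<rho> p \<le> \<rho> q + \<rho> r" using rank_join_le j by auto
  then have "\<rho> q = monomial_rank m" "\<rho> r = monomial_rank n" "\<rho> p = \<rho> q + \<rho> r"
    using p q(2) r(2) unfolding normal_form_def by auto
  then show "\<exists>q r. normal_form m q \<and> normal_form n r \<and> additive_join q r p"
    using j q(1) r(1) unfolding normal_form_def additive_join_def by blast
next
  assume "\<exists>q r. normal_form m q \<and> normal_form n r \<and> additive_join q r p"
  then show "normal_form (m + n) p" unfolding normal_form_def additive_join_iff by auto
qed

section \<open>Functionals that read off normal forms\<close>

definition nf_coeff :: "('p, 'k::field) mpolynomial \<Rightarrow> 'p \<Rightarrow> 'k"
  where "nf_coeff f p = (\<Sum>m\<in>Poly_Mapping.keys f. if normal_form m p then Poly_Mapping.lookup f m else 0)"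

lemma nf_coeff_single [simp]:
  "nf_coeff (Poly_Mapping.single m c) p = (if normal_form m p then c else 0)"
  by (simp add: nf_coeff_def)

lemma nf_coeff_zero [simp]: "nf_coeff 0 p = 0"
  by (simp add: nf_coeff_def)

lemma nf_coeff_add [simp]: "nf_coeff (f + g) p = nf_coeff f p + nf_coeff g p"
  unfolding nf_coeff_def
  by (rule setsum_keys_plus_distrib[where f = "\<lambda>m c. if normal_form m p then c else 0"]) auto

lemma nf_coeff_diff [simp]: "nf_coeff (f - g) p = nf_coeff f p - nf_coeff g p"
  using nf_coeff_add[of "f - g" g p] by (simp add: algebra_simps)

lemma nf_coeff_sum [simp]: "nf_coeff (\<Sum>i\<in>A. f i) p = (\<Sum>i\<in>A. nf_coeff (f i) p)"
  by (induction A rule: infinite_finite_induct) auto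

text \<open>The normal form of \<open>n + m\<close> depends on \<open>m\<close> only through the
  normal form of \<open>m\<close>, so the coefficients of the product depend on \<open>f\<close>
  only through \<open>nf_coeff f\<close>. Hence the common kernel of these functionals is an
  ideal.\<close>

lemma nf_coeff_single_mult:
  "nf_coeff (Poly_Mapping.single n c * f) p =
    (\<Sum>q\<in>UNIV. if \<exists>r. normal_form n r \<and> additive_join r q p then c * nf_coeff f q else 0)"
proof (induction f rule: poly_mapping_single_induct)
  case (add f m d)
  have s: "nf_coeff (Poly_Mapping.single n c * Poly_Mapping.single m d) p =
      (\<Sum>q\<in>UNIV. if \<exists>r. normal_form n r \<and> additive_join r q p
        then c * nf_coeff (Poly_Mapping.single m d) q else 0)"
  \<comment> \<open>A normal form of \<open>m\<close> is unique, so at most one summand is nonzero;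
    if there is none, then \<open>n + m\<close> has none either and both sides vanish.\<close>
  proof (cases "\<exists>q. normal_form m q")
    case True
    then obtain q where q: "normal_form m s \<longleftrightarrow> s = q" for s using normal_form_unique by metis
    have "(\<Sum>s\<in>UNIV. if \<exists>r. normal_form n r \<and> additive_join r s p
        then c * nf_coeff (Poly_Mapping.single m d) s else 0) =
      (\<Sum>s\<in>UNIV. if s = q then (if \<exists>r. normal_form n r \<and> additive_join r q p then c * d else 0) else 0)"
      by (rule sum.cong) (auto simp: q)
    then show ?thesis by (simp add: mult_single normal_form_add q)
  qed (auto simp: mult_single normal_form_add cong: if_cong)
  show ?case
    unfolding distrib_left nf_coeff_add add.IH s sum.distrib[symmetric]
    by (rule sum.cong) (auto simp: distrib_left)
qed (simp cong: if_cong)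

lemma nf_coeff_mult_zero:
  assumes "\<And>p. nf_coeff f p = 0"
  shows "nf_coeff (g * f) p = 0"
proof (induction g rule: poly_mapping_single_induct)
  case (add g n c)
  then show ?case by (simp add: distrib_right nf_coeff_single_mult assms cong: if_cong)
qed simp

lemma nf_coeff_Const_mult [simp]: "nf_coeff (Const c * f) p = c * nf_coeff f p"
  by (simp add: Const_def nf_coeff_single_mult)

lemma nf_coeff_Var [simp]: "nf_coeff (Var x) p = (if p = x then 1 else 0)"
  unfolding Var_def by simp

lemma nf_coeff_Var_mult: "nf_coeff (Var x * Var y) p = (if additive_join x y p then 1 else 0)"
  unfolding Var_def mult_single nf_coeff_single normal_form_add by simp

subsection \<open>The defining ideal\<close>

lemma ideal_poset_ideal: "ideal (poset_ideal \<rho>) (poly_ring :: ('p, 'k::field) mpolynomial ring)"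
  unfolding poset_ideal_def
  by (rule ring.genideal_ideal) (auto intro: ring_from_type_algebra)

lemma poset_ideal_relation: "f \<in> poset_relations \<rho> \<Longrightarrow> f \<in> poset_ideal \<rho>"
  for f :: "('p, 'k::field) mpolynomial"
  unfolding poset_ideal_def
  using ring.genideal_self[OF ring_from_type_algebra, of "poset_relations \<rho>"] by auto

lemma poset_ideal_closed:
  fixes f g :: "('p, 'k::field) mpolynomial"
  shows poset_ideal_zero: "0 \<in> (poset_ideal \<rho> :: ('p, 'k) mpolynomial set)"
    and poset_ideal_add: "f \<in> poset_ideal \<rho> \<Longrightarrow> g \<in> poset_ideal \<rho> \<Longrightarrow> f + g \<in> poset_ideal \<rho>"
    and poset_ideal_mult: "g \<in> poset_ideal \<rho> \<Longrightarrow> f * g \<in> poset_ideal \<rho>"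
proof -
  interpret ideal "poset_ideal \<rho>" "poly_ring :: ('p, 'k) mpolynomial ring"
    by (rule ideal_poset_ideal)
  show "0 \<in> (poset_ideal \<rho> :: ('p, 'k) mpolynomial set)"
    using additive_subgroup.zero_closed[OF is_additive_subgroup] by simp
  show "f \<in> poset_ideal \<rho> \<Longrightarrow> g \<in> poset_ideal \<rho> \<Longrightarrow> f + g \<in> poset_ideal \<rho>"
    using additive_subgroup.a_closed[OF is_additive_subgroup, of f g] by simp
  show "g \<in> poset_ideal \<rho> \<Longrightarrow> f * g \<in> poset_ideal \<rho>" using I_l_closed[of g f] by simp
qed

lemma poset_ideal_sum:
  "(\<And>i. i \<in> A \<Longrightarrow> f i \<in> poset_ideal \<rho>) \<Longrightarrow> (\<Sum>i\<in>A. f i) \<in> poset_ideal \<rho>"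
  for f :: "'i \<Rightarrow> ('p, 'k::field) mpolynomial"
  by (induction A rule: infinite_finite_induct) (auto intro: poset_ideal_zero poset_ideal_add)

text \<open>The common kernel of all \<open>nf_coeff\<close> is an ideal containing the generators,
  hence it contains the ideal they generate.\<close>

lemma poset_ideal_nf_coeff:
  fixes f :: "('p, 'k::field) mpolynomial"
  assumes "f \<in> poset_ideal \<rho>"
  shows "nf_coeff f p = 0"
proof -
  let ?J = "{f :: ('p, 'k) mpolynomial. \<forall>p. nf_coeff f p = 0}"
  interpret ring "poly_ring :: ('p, 'k) mpolynomial ring" by (rule ring_from_type_algebra)
  have "ideal ?J poly_ring"
  proof (rule idealI)
    show "ring (poly_ring :: ('p, 'k) mpolynomial ring)" by (rule ring_from_type_algebra)
    show "subgroup ?J (add_monoid poly_ring)"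
    proof
      fix x :: "('p, 'k) mpolynomial" assume x: "x \<in> ?J"
      have "nf_coeff (0 - x) p = nf_coeff 0 p - nf_coeff x p" for p by (rule nf_coeff_diff)
      then show "inv\<^bsub>add_monoid poly_ring\<^esub> x \<in> ?J"
        using x a_inv_ring_of_type_algebra[of x] by (simp add: a_inv_def)
    qed auto
    show "f \<otimes>\<^bsub>poly_ring\<^esub> g \<in> ?J" "g \<otimes>\<^bsub>poly_ring\<^esub> f \<in> ?J" if "g \<in> ?J" for f g
      using that nf_coeff_mult_zero[of g f] by (simp_all add: mult.commute[of g f])
  qed
  moreover have "poset_relations \<rho> \<subseteq> ?J"
  proof -
    \<comment> \<open>The variable of \<open>bot\<close> and the empty monomial both have normal
      form \<open>bot\<close>, so their contributions cancel.\<close>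
    have "nf_coeff (Var bot - 1) p = (0 :: 'k)" for p
      by (simp flip: single_one)
    then show ?thesis
      unfolding poset_relations_def
      by (auto simp: nf_coeff_Var_mult additive_join_def split: if_splits)
  qed
  ultimately have "poset_ideal \<rho> \<subseteq> ?J"
    unfolding poset_ideal_def by (rule genideal_minimal)
  then show ?thesis using assms by auto
qed

lemma poset_coset_eq_iff:
  "poset_ideal \<rho> +>\<^bsub>poly_ring\<^esub> f = poset_ideal \<rho> +>\<^bsub>poly_ring\<^esub> g \<longleftrightarrow> f - g \<in> poset_ideal \<rho>"
  for f g :: "('p, 'k::field) mpolynomial"
  using ring.quotient_eq_iff_same_a_r_cos[OF ring_from_type_algebra ideal_poset_ideal, of f g]
  by simp

subsection \<open>Linear combinations of the variables\<close>

definition linear_form :: "('p \<Rightarrow> 'k) \<Rightarrow> ('p, 'k::field) mpolynomial"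
  where "linear_form c = (\<Sum>x\<in>UNIV. Const (c x) * Var x)"

lemma linear_form_add: "linear_form (\<lambda>x. a x + b x) = linear_form a + linear_form b"
  by (simp add: linear_form_def Const_def single_add distrib_right sum.distrib)

lemma linear_form_scale: "linear_form (\<lambda>x. d * c x) = Const d * linear_form c"
  by (simp add: linear_form_def Const_def sum_distrib_left mult_single flip: mult.assoc)

lemma linear_form_delta: "linear_form (\<lambda>x. if x = y then d else 0) = Const d * Var y"
proof -
  have "linear_form (\<lambda>x. if x = y then d else 0) = (\<Sum>x\<in>UNIV. if x = y then Const d * Var y else 0)"
    unfolding linear_form_def by (rule sum.cong) (auto simp: Const_def)
  then show ?thesis by simp
qed

lemma nf_coeff_linear_form [simp]: "nf_coeff (linear_form c) p = c p"
  by (simp add: linear_form_def if_distrib[of "\<lambda>d. _ * d"] cong: if_cong)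

text \<open>A uniform shape for the three kinds of quadratic relations: the sum has at most one
  nonzero term, and none when the product itself is a relation.\<close>

lemma Var_mult_mod_poset_ideal:
  "(Var x * Var y - (\<Sum>p\<in>UNIV. if additive_join x y p then Var p else 0)
    :: ('p, 'k::field) mpolynomial) \<in> poset_ideal \<rho>"
proof (cases "additive_join x y (poset_join x y)")
  case True
  then have "additive_join x y p \<longleftrightarrow> p = poset_join x y" for p by (auto simp: additive_join_def)
  moreover have "(Var x * Var y - Var (poset_join x y) :: ('p, 'k) mpolynomial) \<in> poset_relations \<rho>"
    using True unfolding poset_relations_def additive_join_def by blast
  ultimately show ?thesis using poset_ideal_relation by simp
next
  case False
  then have no: "\<not> additive_join x y p" for p by (auto simp: additive_join_def)
  \<comment> \<open>By subadditivity an additive join fails only through a missing upper bound or a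
    strict drop in rank.\<close>
  have "(Var x * Var y :: ('p, 'k) mpolynomial) \<in> poset_relations \<rho>"
    using False rank_join_le[of x y] unfolding poset_relations_def additive_join_def
    by (cases "upper_bounds x y = {}") (blast, simp, metis order_le_imp_less_or_eq)
  then show ?thesis using poset_ideal_relation by (simp add: no)
qed

text \<open>The multiplication of both algebras in coordinates, with structure constants 0 and 1
  given by \<open>additive_join\<close>.\<close>

definition structure_product :: "('p \<Rightarrow> 'k) \<Rightarrow> ('p \<Rightarrow> 'k) \<Rightarrow> 'p \<Rightarrow> 'k::field"
  where "structure_product a b p =
    (\<Sum>x\<in>UNIV. \<Sum>y\<in>UNIV. if additive_join x y p then a x * b y else 0)"

lemma linear_form_mult:
  fixes a b :: "'p \<Rightarrow> 'k::field"
  shows "linear_form a * linear_form b - linear_form (structure_product a b) \<in> poset_ideal \<rho>"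
proof -
  have C: "Const (c * d) = Const c * Const d" for c d :: 'k by (simp add: Const_def mult_single)
  have Csum: "Const (sum f A) = (\<Sum>i\<in>A. Const (f i))" for f :: "'p \<Rightarrow> 'k" and A
    by (induction A rule: infinite_finite_induct) (simp_all add: Const_def single_add)
  have 1: "linear_form a * linear_form b =
      (\<Sum>x\<in>UNIV. \<Sum>y\<in>UNIV. Const (a x * b y) * (Var x * Var y))"
    unfolding linear_form_def sum_product by (intro sum.cong refl) (simp add: C mult_ac)
  have "linear_form (structure_product a b) =
      (\<Sum>p\<in>UNIV. \<Sum>x\<in>UNIV. \<Sum>y\<in>UNIV. Const (a x * b y) * (if additive_join x y p then Var p else 0))"
    unfolding linear_form_def structure_product_def Csum sum_distrib_right
    by (intro sum.cong refl) (auto simp: Const_def)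
  \<comment> \<open>With the sum over \<open>p\<close> innermost, each pair \<open>x\<close>,
    \<open>y\<close> meets its own relation.\<close>
  also have "\<dots> =
      (\<Sum>x\<in>UNIV. \<Sum>y\<in>UNIV. Const (a x * b y) * (\<Sum>p\<in>UNIV. if additive_join x y p then Var p else 0))"
    unfolding sum_distrib_left by (rule trans[OF sum.swap], rule sum.cong[OF refl], rule sum.swap)
  finally show ?thesis
    unfolding 1
    by (auto simp flip: sum_subtractf right_diff_distrib
        intro!: poset_ideal_sum poset_ideal_mult Var_mult_mod_poset_ideal)
qed

text \<open>The relation for \<open>bot\<close> turns a constant into a linear form, and linear
  forms are closed under products modulo the ideal, so multiplying by one variable at a time stays
  among them.\<close>

lemma linear_form_surj:
  fixes f :: "('p, 'k::field) mpolynomial"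
  shows "\<exists>c. f - linear_form c \<in> poset_ideal \<rho>"
proof (induction f rule: poly_mapping_single_induct)
  case zero
  have "linear_form (\<lambda>x. 0 :: 'k) = 0" by (simp add: linear_form_def Const_def)
  then show ?case using poset_ideal_zero by (metis diff_self)
next
  case (add f m d)
  have "\<exists>c. Poly_Mapping.single m d - linear_form c \<in> poset_ideal \<rho>"
  proof (induction m rule: monomial_induct)
    case zero
    have "Var bot - 1 \<in> (poset_ideal \<rho> :: ('p, 'k) mpolynomial set)"
      by (rule poset_ideal_relation) (simp add: poset_relations_def)
    then have "- Const d * (Var bot - 1) \<in> poset_ideal \<rho>" by (rule poset_ideal_mult)
    then have "Poly_Mapping.single 0 d - linear_form (\<lambda>x. if x = bot then d else 0) \<in> poset_ideal \<rho>"
      unfolding linear_form_delta by (simp add: algebra_simps flip: Const_def)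
    then show ?case by blast
  next
    case (add m a)
    then obtain c where c: "Poly_Mapping.single m d - linear_form c \<in> poset_ideal \<rho>" by blast
    let ?e = "\<lambda>x. if x = a then 1 else 0 :: 'k"
    have e: "linear_form ?e = Var a" unfolding linear_form_delta by (simp add: Const_def)
    \<comment> \<open>The product \<open>linear_form c * Var a\<close> cancels between the two
      summands, leaving \<open>structure_product c ?e\<close> as the new coefficients.\<close>
    have "Var a * (Poly_Mapping.single m d - linear_form c)
        + (linear_form c * linear_form ?e - linear_form (structure_product c ?e)) \<in> poset_ideal \<rho>"
      by (intro poset_ideal_add poset_ideal_mult c linear_form_mult)
    also have "Var a * (Poly_Mapping.single m d - linear_form c)
        + (linear_form c * linear_form ?e - linear_form (structure_product c ?e))
      = Poly_Mapping.single (m + Poly_Mapping.single a 1) d - linear_form (structure_product c ?e)"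
      unfolding e by (simp add: algebra_simps Var_def mult_single)
    finally show ?case by blast
  qed
  then obtain c c' where "(f - linear_form c) + (Poly_Mapping.single m d - linear_form c') \<in> poset_ideal \<rho>"
    using add poset_ideal_add by blast
  then have "f + Poly_Mapping.single m d - linear_form (\<lambda>x. c x + c' x) \<in> poset_ideal \<rho>"
    unfolding linear_form_add by (simp add: algebra_simps)
  then show ?case by blast
qed

subsection \<open>The schemoid algebra\<close>

lemma Mor_poset_category: "(x, y, d) \<in> Mor (poset_category \<rho>) \<longleftrightarrow> additive_join x d y"
  by (auto simp: poset_category_def additive_join_def)

text \<open>Elements of the schemoid algebra are constant on the fibers of the label, and each fiber
  contains exactly one morphism with source \<open>bot\<close>, so the coefficients there are coordinates.\<close>

definition label_coeff :: "('p \<times> 'p \<times> 'p \<Rightarrow>\<^sub>0 'k::field) \<Rightarrow> 'p \<Rightarrow> 'k"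
  where "label_coeff a d = Poly_Mapping.lookup a (bot, d, d)"

abbreviation poset_schemoid_algebra :: "('k::field, 'p \<times> 'p \<times> 'p \<Rightarrow>\<^sub>0 'k) module"
  where "poset_schemoid_algebra \<equiv> schemoid_algebra (poset_category \<rho>) UNIV label"

lemma lookup_fiber_sum:
  "Poly_Mapping.lookup (fiber_sum (poset_category \<rho>) label d) (x, y, e) =
    (if additive_join x e y \<and> e = d then 1 else 0)"
  by (simp add: fiber_sum_def lookup_sum lookup_single when_def label_def Mor_poset_category)

text \<open>Both sides are linear in \<open>a\<close>, so fiber sums suffice; there
  \<open>(bot, d, d)\<close> is always a morphism.\<close>

lemma lookup_schemoid_algebra:
  fixes a :: "'p \<times> 'p \<times> 'p \<Rightarrow>\<^sub>0 'k::field"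
  assumes "a \<in> carrier poset_schemoid_algebra"
  shows "Poly_Mapping.lookup a (x, y, d) = (if additive_join x d y then label_coeff a d else 0)"
proof -
  interpret vs: vector_space "scale :: 'k \<Rightarrow> ('p \<times> 'p \<times> 'p \<Rightarrow>\<^sub>0 'k) \<Rightarrow> _" by (rule vector_space_scale)
  have "a \<in> vs.span (range (fiber_sum (poset_category \<rho>) label))"
    using assms by (simp add: schemoid_algebra_def)
  then show ?thesis
    by (induction a rule: vs.span_induct_alt)
      (auto simp: lookup_add label_coeff_def lookup_fiber_sum split: if_splits)
qed

lemma label_coeff_inj:
  assumes "a \<in> carrier poset_schemoid_algebra" "b \<in> carrier poset_schemoid_algebra"
    and "label_coeff a = label_coeff b"
  shows "a = b"
  using assms by (intro poly_mapping_eqI) (auto simp: lookup_schemoid_algebra)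

lemma label_coeff_surj:
  fixes c :: "'p \<Rightarrow> 'k::field"
  shows "\<exists>a\<in>carrier poset_schemoid_algebra. label_coeff a = c"
proof
  interpret vs: vector_space "scale :: 'k \<Rightarrow> ('p \<times> 'p \<times> 'p \<Rightarrow>\<^sub>0 'k) \<Rightarrow> _" by (rule vector_space_scale)
  let ?a = "\<Sum>d\<in>UNIV. scale (c d) (fiber_sum (poset_category \<rho>) label d)"
  show "?a \<in> carrier poset_schemoid_algebra"
    by (simp add: schemoid_algebra_def vs.span_sum vs.span_scale vs.span_base)
  show "label_coeff ?a = c"
    by (rule ext)
      (simp add: label_coeff_def lookup_sum lookup_fiber_sum if_distrib[of "\<lambda>d. _ * d"] cong: if_cong)
qed

lemma label_coeff_one: "label_coeff \<one>\<^bsub>poset_schemoid_algebra\<^esub> = (\<lambda>d. if d = bot then 1 else 0)"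
  by (rule ext) (auto simp: label_coeff_def schemoid_algebra_def category_algebra_def
      poset_category_def lookup_sum lookup_single when_def intro!: sum.neutral)

lemma label_coeff_mult:
  fixes a b :: "'p \<times> 'p \<times> 'p \<Rightarrow>\<^sub>0 'k::field"
  assumes a: "a \<in> carrier poset_schemoid_algebra" and b: "b \<in> carrier poset_schemoid_algebra"
  shows "label_coeff (a \<otimes>\<^bsub>poset_schemoid_algebra\<^esub> b) =
    structure_product (label_coeff a) (label_coeff b)"
proof
  fix p
  let ?C = "poset_category \<rho>"
  \<comment> \<open>The contribution of a pair to the coefficient at \<open>(bot, p, p)\<close>,
    defined on all pairs so that the sum can leave the supports of \<open>a\<close> and
    \<open>b\<close> and be reindexed by pairs of labels.\<close>
  define F where "F = (\<lambda>(g, f). if src ?C g = tgt ?C f \<and> Comp ?C g f = (bot, p, p)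
    then Poly_Mapping.lookup a g * Poly_Mapping.lookup b f else 0)"
  define \<phi> :: "'p \<times> 'p \<Rightarrow> ('p \<times> 'p \<times> 'p) \<times> ('p \<times> 'p \<times> 'p)"
    where "\<phi> = (\<lambda>(d, c). ((c, p, d), (bot, c, c)))"
  have "label_coeff (a \<otimes>\<^bsub>poset_schemoid_algebra\<^esub> b) p =
      (\<Sum>g\<in>Poly_Mapping.keys a. \<Sum>f\<in>Poly_Mapping.keys b. F (g, f))"
    unfolding label_coeff_def F_def schemoid_algebra_def category_algebra_def
    by (auto simp: lookup_sum lookup_single when_def intro!: sum.cong)
  also have "\<dots> = (\<Sum>gf\<in>Poly_Mapping.keys a \<times> Poly_Mapping.keys b. F gf)"
    by (simp add: sum.cartesian_product)
  also have "\<dots> = (\<Sum>gf\<in>UNIV. F gf)"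
    by (rule sum.mono_neutral_left) (auto simp: F_def in_keys_iff split: if_splits)
  also have "\<dots> = (\<Sum>gf\<in>range \<phi>. F gf)"
  proof (rule sum.mono_neutral_right)
    have "gf \<in> range \<phi>" if "F gf \<noteq> 0" for gf
    proof -
      obtain y z d x y' c where e: "gf = ((y, z, d), (x, y', c))" by (metis prod.collapse)
      \<comment> \<open>The composite fixes the source \<open>bot\<close> and the target
        \<open>p\<close>; a nonzero coefficient of \<open>b\<close> at \<open>(bot, y', c)\<close>
        forces \<open>y' = c\<close>.\<close>
      have "gf = \<phi> (d, c)"
        using that
        by (auto simp: e F_def \<phi>_def poset_category_def lookup_schemoid_algebra[OF b] split: if_splits)
      then show ?thesis by blast
    qed
    then show "\<forall>gf\<in>UNIV - range \<phi>. F gf = 0" by blast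
  qed auto
  also have "\<dots> = (\<Sum>dc\<in>UNIV. F (\<phi> dc))"
    by (rule sum.reindex_cong[of \<phi>]) (auto simp: \<phi>_def inj_on_def)
  also have "\<dots> = structure_product (label_coeff a) (label_coeff b) p"
  proof -
    have "F (\<phi> (d, c)) = (if additive_join d c p then label_coeff a d * label_coeff b c else 0)" for d c
    proof -
      \<comment> \<open>The coefficient of \<open>a\<close> at \<open>(c, p, d)\<close> involves the
        join of \<open>c\<close> and \<open>d\<close>, the structure product that of
        \<open>d\<close> and \<open>c\<close>.\<close>
      have "additive_join c d p \<longleftrightarrow> additive_join d c p" by (auto simp: additive_join_iff)
      then show ?thesis
        by (auto simp: F_def \<phi>_def poset_category_def lookup_schemoid_algebra[OF a]
            lookup_schemoid_algebra[OF b]) (auto simp: additive_join_def)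
    qed
    then show ?thesis
      by (simp only: structure_product_def sum.cartesian_product UNIV_Times_UNIV)
        (auto intro!: sum.cong)
  qed
  finally show "label_coeff (a \<otimes>\<^bsub>poset_schemoid_algebra\<^esub> b) p =
    structure_product (label_coeff a) (label_coeff b) p" .
qed

text \<open>Label coefficients identify the domain with all coefficient functions, and every class
  of the quotient contains exactly one linear form.\<close>

lemma schemoid_algebra_iso_poset_ring:
  "(\<lambda>a. poset_ideal \<rho> +>\<^bsub>poly_ring\<^esub> linear_form (label_coeff a)) \<in>
    algebra_iso poset_schemoid_algebra (poset_ring \<rho> :: ('k::field, ('p, 'k) mpolynomial set) module)"
  (is "?h \<in> algebra_iso ?A ?B")
proof -
  let ?R = "poly_ring :: ('p, 'k) mpolynomial ring"
  let ?I = "poset_ideal \<rho> :: ('p, 'k) mpolynomial set"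
  interpret ideal ?I ?R by (rule ideal_poset_ideal)
  \<comment> \<open>The quotient operations on representatives; a scalar \<open>c\<close> acts
    through the class of \<open>Const c\<close>.\<close>
  have B: "carrier ?B = range (\<lambda>f. ?I +>\<^bsub>?R\<^esub> f)" "\<one>\<^bsub>?B\<^esub> = ?I +>\<^bsub>?R\<^esub> 1"
    "(?I +>\<^bsub>?R\<^esub> f) \<otimes>\<^bsub>?B\<^esub> (?I +>\<^bsub>?R\<^esub> g) = ?I +>\<^bsub>?R\<^esub> (f * g)"
    "(?I +>\<^bsub>?R\<^esub> f) \<oplus>\<^bsub>?B\<^esub> (?I +>\<^bsub>?R\<^esub> g) = ?I +>\<^bsub>?R\<^esub> (f + g)"
    "c \<odot>\<^bsub>?B\<^esub> (?I +>\<^bsub>?R\<^esub> g) = ?I +>\<^bsub>?R\<^esub> (Const c * g)" for f g c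
    using rcoset_mult_add[of f g] rcoset_mult_add[of "Const c" g] a_rcos_sum[of f g]
    by (auto simp: poset_ring_def ring.defs module.defs FactRing_def A_RCOSETS_def')
  have hom: "?h \<in> ring_hom ?A ?B"
  proof (rule ring_hom_memI)
    fix a b assume ab: "a \<in> carrier ?A" "b \<in> carrier ?A"
    show "?h a \<in> carrier ?B" by (simp add: B)
    show "?h (a \<otimes>\<^bsub>?A\<^esub> b) = ?h a \<otimes>\<^bsub>?B\<^esub> ?h b"
      using linear_form_mult[of "label_coeff a" "label_coeff b"]
      by (simp add: B label_coeff_mult[OF ab] flip: poset_coset_eq_iff)
    have "label_coeff (a \<oplus>\<^bsub>?A\<^esub> b) = (\<lambda>x. label_coeff a x + label_coeff b x)"
      by (rule ext) (simp add: label_coeff_def schemoid_algebra_def category_algebra_def lookup_add)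
    then show "?h (a \<oplus>\<^bsub>?A\<^esub> b) = ?h a \<oplus>\<^bsub>?B\<^esub> ?h b"
      by (simp add: B linear_form_add)
  next
    \<comment> \<open>The coefficients of the unit are concentrated at \<open>bot\<close>, so its
      image is the class of \<open>Var bot\<close>.\<close>
    have "Var bot - 1 \<in> ?I"
      by (rule poset_ideal_relation) (simp add: poset_relations_def)
    then show "?h \<one>\<^bsub>?A\<^esub> = \<one>\<^bsub>?B\<^esub>"
      by (simp add: B label_coeff_one linear_form_delta poset_coset_eq_iff) (simp add: Const_def)
  qed
  have bij: "bij_betw ?h (carrier ?A) (carrier ?B)"
    unfolding bij_betw_def
  proof
    show "inj_on ?h (carrier ?A)"
    proof (rule inj_onI)
      fix a b assume ab: "a \<in> carrier ?A" "b \<in> carrier ?A" and "?h a = ?h b"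
      then have "linear_form (label_coeff a) - linear_form (label_coeff b) \<in> ?I"
        by (simp add: poset_coset_eq_iff)
      \<comment> \<open>On a difference of linear forms, \<open>nf_coeff\<close> at \<open>p\<close>
        is the difference of the coefficients at \<open>p\<close>.\<close>
      from poset_ideal_nf_coeff[OF this] have "label_coeff a = label_coeff b"
        by (simp add: fun_eq_iff)
      then show "a = b" using ab label_coeff_inj by blast
    qed
    have "?I +>\<^bsub>?R\<^esub> f \<in> ?h ` carrier ?A" for f
    proof -
      obtain c where "f - linear_form c \<in> ?I" using linear_form_surj by blast
      moreover obtain a :: "'p \<times> 'p \<times> 'p \<Rightarrow>\<^sub>0 'k" where "a \<in> carrier ?A" "label_coeff a = c"
        using label_coeff_surj by blast
      ultimately show ?thesis by (auto simp: poset_coset_eq_iff)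
    qed
    then show "?h ` carrier ?A = carrier ?B" by (auto simp: B)
  qed
  have "?h (c \<odot>\<^bsub>?A\<^esub> a) = c \<odot>\<^bsub>?B\<^esub> ?h a" for c a
  proof -
    have "label_coeff (c \<odot>\<^bsub>?A\<^esub> a) = (\<lambda>x. c * label_coeff a x)"
      by (rule ext) (simp add: label_coeff_def schemoid_algebra_def category_algebra_def)
    then show ?thesis by (simp add: B linear_form_scale)
  qed
  then show ?thesis using hom bij by (simp add: algebra_iso_def ring_iso_def)
qed

end

theorem theorem3p9:
  fixes \<rho> :: "'p::{finite, order_bot} \<Rightarrow> nat"
  assumes "\<And>x y :: 'p. card (minimal_elements (upper_bounds x y)) \<le> 1"
    and "rank_function \<rho>"
    and "\<And>x y. upper_bounds x y \<noteq> {} \<Longrightarrow> \<rho> (poset_join x y) \<le> \<rho> x + \<rho> y"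
  shows "\<exists>h. h \<in> algebra_iso
      (schemoid_algebra (poset_category \<rho>) UNIV label :: ('k::field, 'p \<times> 'p \<times> 'p \<Rightarrow>\<^sub>0 'k) module)
      (poset_ring \<rho> :: ('k, ('p, 'k) mpolynomial set) module)"
proof -
  interpret ranked_join_poset \<rho> by unfold_locales (use assms in auto)
  show ?thesis using schemoid_algebra_iso_poset_ring by blast
qed

end
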